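(* Let $(X,d)$ be a metric space, $Y$ a real vector space, $K\subset Y$ a convex cone, $H\subset K$ a nonempty $K$-convex set with $0\notin \mathrm{vcl}(H+K)$, $f:X\to 2^Y$ a set-valued map, $x_0\in X$, $\epsilon>0$ and $\lambda>0$. For any $x\in X$, put $$S(x):=\Big\{x'\in X:\ f(x)\subset f(x')+\frac{\epsilon}{\lambda}d(x,x')H+K\Big\}.$$ Suppose that the following conditions are satisfied: (i) $(X,d)$ is $S(x_0)$-dynamically complete; (ii) $f(x_0)\not\subset f(S(x_0))+\epsilon H+K$; (iii) for any $x\in S(x_0)$, $S(x)$ is closed (or, $S(x)$ is dynamically closed). Then there exists $\bar x\in X$ such that (a) $f(x_0)\subset f(\bar x)+(\epsilon/\lambda)d(x_0,\bar x)H+K$; (b) $f(\bar x)\not\subset f(x)+(\epsilon/\lambda)d(\bar x,x)H+K$ for all $x\in X\setminus\{\bar x\}$; (c) $d(x_0,\bar x)\le\lambda$.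
   Context: $2^Y$ is the family of all subsets of $Y$; for $A\subset X$, $f(A)=\bigcup_{x\in A}f(x)$. For $A,B\subset Y$ and $\alpha\in\mathbb R$, $A+B=\{a+b:a\in A,b\in B\}$ and $\alpha A=\{\alpha a:a\in A\}$. A cone is a nonempty set $K\subset Y$ with $\alpha K\subset K$ for all $\alpha\ge 0$; it is a convex cone if also $K+K\subset K$. Cones are always assumed nontrivial: $K\ne\{0\}$ and $K\ne Y$. A set $H$ is $K$-convex if $H+K$ is convex. For nonempty $A\subset Y$, the vector closure is $\mathrm{vcl}(A)=\{y\in Y:\exists v\in Y,\ \exists \lambda_n\ge 0,\ \lambda_n\to 0 \text{ with } y+\lambda_n v\in A\ \forall n\in\mathbb N\}$. $S(x)$ is dynamically closed if whenever $(x_n)\subset S(x)$ is a sequence with $x_{n+1}\in S(x_n)$ for all $n$ and $x_n\to\bar x$ in $X$, then $\bar x\in S(x)$. $(X,d)$ is $S(x)$-dynamically complete if for any Cauchy sequence $(x_n)\subset S(x)$ with $x_{n+1}\in S(x_n)$ for all $n$, there exists $\bar x\in X$ with $x_n\to\bar x$. In (iii) either alternative suffices. *)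

theory Defs
  imports "HOL-Analysis.Analysis"
begin

text \<open>
  Sums of sets are the pointwise sums of \<^theory>\<open>HOL-Library.Set_Algebras\<close>, and the dilate
  \<open>\<alpha>A\<close> is the image of \<open>A\<close> under \<open>(*\<^sub>R) \<alpha>\<close>.  The predicate \<^const>\<open>convex_cone\<close> includes
  nonemptiness.  It asks for convexity and closure under nonnegative scaling, which is the same
  as closure under nonnegative scaling and addition:
\<close>

lemma convex_cone_iff_scale_add:
  fixes K :: "'b::real_vector set"
  shows "convex_cone K \<longleftrightarrow> K \<noteq> {} \<and> (\<forall>\<alpha>\<ge>0. (*\<^sub>R) \<alpha> ` K \<subseteq> K) \<and> K + K \<subseteq> K"
proof -
  have "K + K \<subseteq> K \<longleftrightarrow> (\<forall>x\<in>K. \<forall>y\<in>K. x + y \<in> K)"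
    unfolding set_plus_def by blast
  moreover have "(\<forall>\<alpha>\<ge>0. (*\<^sub>R) \<alpha> ` K \<subseteq> K) \<longleftrightarrow> (\<forall>x\<in>K. \<forall>\<alpha>\<ge>0. \<alpha> *\<^sub>R x \<in> K)"
    unfolding image_subset_iff by blast
  moreover have "0 \<in> K \<longleftrightarrow> K \<noteq> {}" if "\<forall>x\<in>K. \<forall>\<alpha>\<ge>0. \<alpha> *\<^sub>R x \<in> K"
  proof
    assume "K \<noteq> {}"
    then obtain x where "x \<in> K"
      by blast
    with that have "(0::real) *\<^sub>R x \<in> K"
      by blast
    then show "0 \<in> K"
      by simp
  qed blast
  ultimately show ?thesis
    unfolding convex_cone_iff by argo
qed

definition cone_convex :: "'b::real_vector set \<Rightarrow> 'b set \<Rightarrow> bool"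
  where "cone_convex K H \<longleftrightarrow> convex (H + K)"

text \<open>Vector closure: no topology on the vector space is involved, and \<open>\<lambda>\<^sub>n = 0\<close> is allowed.\<close>

definition vcl :: "'b::real_vector set \<Rightarrow> 'b set"
  where "vcl A = {y. \<exists>v. \<exists>l :: nat \<Rightarrow> real.
    (\<forall>n. l n \<ge> 0) \<and> l \<longlonglongrightarrow> 0 \<and> (\<forall>n. y + l n *\<^sub>R v \<in> A)}"

definition set_image :: "('a \<Rightarrow> 'b set) \<Rightarrow> 'a set \<Rightarrow> 'b set"
  where "set_image f A = (\<Union>x\<in>A. f x)"

definition ekeland_slice ::
    "('a::metric_space \<Rightarrow> 'b::real_vector set) \<Rightarrow> 'b set \<Rightarrow> 'b set \<Rightarrow> real \<Rightarrow> real \<Rightarrow> 'a \<Rightarrow> 'a set"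
  where "ekeland_slice f H K \<epsilon> l x =
    {x'. f x \<subseteq> f x' + (*\<^sub>R) (\<epsilon> / l * dist x x') ` H + K}"

text \<open>
  In the next two definitions \<open>S\<close> is the whole set-valued map, since the condition
  \<open>x\<^sub>n\<^sub>+\<^sub>1 \<in> S(x\<^sub>n)\<close> uses its values away from \<open>x\<close>.
\<close>

definition dynamically_closed :: "('a::metric_space \<Rightarrow> 'a set) \<Rightarrow> 'a \<Rightarrow> bool"
  where "dynamically_closed S x \<longleftrightarrow>
    (\<forall>u xbar. range u \<subseteq> S x \<longrightarrow> (\<forall>n. u (Suc n) \<in> S (u n)) \<longrightarrow> u \<longlonglongrightarrow> xbar \<longrightarrow> xbar \<in> S x)"

definition dynamically_complete :: "('a::metric_space \<Rightarrow> 'a set) \<Rightarrow> 'a \<Rightarrow> bool"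
  where "dynamically_complete S x \<longleftrightarrow>
    (\<forall>u. Cauchy u \<longrightarrow> range u \<subseteq> S x \<longrightarrow> (\<forall>n. u (Suc n) \<in> S (u n)) \<longrightarrow> (\<exists>xbar. u \<longlonglongrightarrow> xbar))"

end

theory Submission
  imports Defs
begin

text \<open>
  Write \<open>S\<close> for the Ekeland slice map and \<open>c = \<epsilon> / l\<close>.  Because \<open>H\<close> is \<open>K\<close>-convex, the dilates
  satisfy \<open>sH + tH + K \<subseteq> (s + t)H + K\<close> for \<open>s, t \<ge> 0\<close>, and because \<open>H \<subseteq> K\<close> the sets \<open>tH + K\<close> shrink as \<open>t\<close>
  grows.  With the triangle inequality the two facts make \<open>S\<close> transitive.

  Failure of the inclusion for \<open>x0\<close> provides a single point \<open>y0 \<in> f x0\<close> outside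
  \<open>f(S x0) + \<epsilon>H + K\<close>, and this point turns the vector problem into a scalar one: let \<open>\<phi> x\<close> be the
  supremum of all \<open>t \<ge> 0\<close> with \<open>y0 \<in> f x + tH + K\<close>.  On \<open>S x0\<close> every such \<open>t\<close> is below \<open>\<epsilon>\<close>, since
  the sets shrink in \<open>t\<close>; so \<open>\<phi>\<close> is finite and bounded there.  Passing from \<open>x\<close> to
  \<open>x' \<in> S x\<close> adds \<open>c d(x,x')\<close> to each admissible \<open>t\<close>, so \<open>\<phi>\<close> grows by at least \<open>c d(x,x')\<close>
  (\<open>dilate_levels_add\<close>).

  What remains is the scalar principle \<open>exists_trivial_slice\<close>: greedily following points of \<open>S\<close>
  whose value \<open>\<phi>\<close> is nearly maximal produces a Cauchy sequence whose limit \<open>xbar\<close> has the slice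
  \<open>{xbar}\<close>; this is (b).  Assertion (a) is \<open>xbar \<in> S x0\<close>, and it says that \<open>c d(x0,xbar)\<close> is an
  admissible \<open>t\<close> at \<open>xbar\<close>, hence less than \<open>\<epsilon> = c l\<close>, which gives (c).
\<close>

section \<open>Dilates of a cone-convex set\<close>

lemma mem_plus_dilate_plus_iff:
  "y \<in> A + (*\<^sub>R) t ` H + K \<longleftrightarrow> (\<exists>a\<in>A. \<exists>h\<in>H. \<exists>k\<in>K. y = a + t *\<^sub>R h + k)"
  by (auto simp: set_plus_def)

lemma plus_dilate_plus_antimono:
  fixes K H A :: "'b::real_vector set"
  assumes K: "convex_cone K" and "H \<subseteq> K" and "r \<le> s"
  shows "A + (*\<^sub>R) s ` H + K \<subseteq> A + (*\<^sub>R) r ` H + K"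
proof
  fix y assume "y \<in> A + (*\<^sub>R) s ` H + K"
  then obtain a h k where ahk: "a \<in> A" "h \<in> H" "k \<in> K" "y = a + s *\<^sub>R h + k"
    unfolding mem_plus_dilate_plus_iff by blast
  have "(s - r) *\<^sub>R h + k \<in> K"
    using K ahk assms(2,3) by (auto simp: convex_cone_iff)
  moreover have "y = a + r *\<^sub>R h + ((s - r) *\<^sub>R h + k)"
    using ahk by (simp add: algebra_simps)
  ultimately show "y \<in> A + (*\<^sub>R) r ` H + K"
    using ahk unfolding mem_plus_dilate_plus_iff by blast
qed

text \<open>
  For \<open>s + t > 0\<close>, division by \<open>s + t\<close> turns a sum in \<open>sH + tH\<close> into a convex combination of points
  of \<open>H \<subseteq> H + K\<close>, which stays in the convex set \<open>H + K\<close>; scaling back leaves an error in \<open>K\<close>.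
\<close>

lemma dilate_add_cone_convex:
  fixes K H :: "'b::real_vector set"
  assumes K: "convex_cone K" and HK: "cone_convex K H"
    and h: "h1 \<in> H" "h2 \<in> H" and st: "0 \<le> s" "0 \<le> t"
  obtains h k where "h \<in> H" "k \<in> K" "s *\<^sub>R h1 + t *\<^sub>R h2 = (s + t) *\<^sub>R h + k"
proof (cases "s + t = 0")
  case True
  then have "s = 0" "t = 0" using st by auto
  moreover have "0 \<in> K" using K by (simp add: convex_cone_iff)
  ultimately show thesis using h that[of h1 0] by simp
next
  case False
  then have pos: "s + t > 0" using st by simp
  have "H \<subseteq> H + K"
    using K by (force simp: convex_cone_iff set_plus_def)
  then have "h1 \<in> H + K" "h2 \<in> H + K"
    using h by auto
  moreover have "s / (s + t) + t / (s + t) = 1"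
    using pos by (simp add: add_divide_distrib[symmetric])
  ultimately have "(s / (s + t)) *\<^sub>R h1 + (t / (s + t)) *\<^sub>R h2 \<in> H + K"
    using HK st unfolding cone_convex_def by (intro convexD) auto
  then obtain h k where hk: "h \<in> H" "k \<in> K"
      "(s / (s + t)) *\<^sub>R h1 + (t / (s + t)) *\<^sub>R h2 = h + k"
    by (auto simp: set_plus_def)
  have "s *\<^sub>R h1 + t *\<^sub>R h2 = (s + t) *\<^sub>R ((s / (s + t)) *\<^sub>R h1 + (t / (s + t)) *\<^sub>R h2)"
    using pos by (simp add: scaleR_add_right)
  also have "\<dots> = (s + t) *\<^sub>R h + (s + t) *\<^sub>R k"
    using hk by (simp add: scaleR_add_right)
  finally show thesis
    using that[of h "(s + t) *\<^sub>R k"] hk K pos by (auto simp: convex_cone_iff)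
qed

text \<open>
  The additivity behind both uses of the slices: it makes them transitive, and it makes the scalar
  value along them increase by the scaled distance.
\<close>

lemma dilate_levels_add:
  fixes K H :: "'b::real_vector set"
  assumes K: "convex_cone K" and HK: "cone_convex K H"
    and "0 \<le> s" "0 \<le> t"
    and y: "y \<in> A + (*\<^sub>R) s ` H + K" and AB: "A \<subseteq> B + (*\<^sub>R) t ` H + K"
  shows "y \<in> B + (*\<^sub>R) (s + t) ` H + K"
proof -
  obtain a h1 k1 where 1: "a \<in> A" "h1 \<in> H" "k1 \<in> K" "y = a + s *\<^sub>R h1 + k1"
    using y unfolding mem_plus_dilate_plus_iff by blast
  obtain b h2 k2 where 2: "b \<in> B" "h2 \<in> H" "k2 \<in> K" "a = b + t *\<^sub>R h2 + k2"
    using AB 1(1) unfolding subset_iff mem_plus_dilate_plus_iff by blast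
  obtain h k where 3: "h \<in> H" "k \<in> K" "s *\<^sub>R h1 + t *\<^sub>R h2 = (s + t) *\<^sub>R h + k"
    using dilate_add_cone_convex[OF K HK 1(2) 2(2) assms(3,4)] by blast
  have "y = b + (s *\<^sub>R h1 + t *\<^sub>R h2) + (k1 + k2)"
    using 1 2 by (simp add: algebra_simps)
  then have "y = b + (s + t) *\<^sub>R h + (k + (k1 + k2))"
    by (simp add: 3 add.assoc)
  moreover have "k + (k1 + k2) \<in> K"
    using K 1 2 3 by (auto simp: convex_cone_iff)
  ultimately show ?thesis
    using 2 3 unfolding mem_plus_dilate_plus_iff by blast
qed

section \<open>Ekeland slices\<close>

lemma ekeland_slice_refl:
  assumes "convex_cone K" and "H \<noteq> {}"
  shows "x \<in> ekeland_slice f H K \<epsilon> l x"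
proof -
  have "0 \<in> K" using assms(1) by (simp add: convex_cone_iff)
  then show ?thesis
    using assms(2) unfolding ekeland_slice_def subset_iff mem_plus_dilate_plus_iff by force
qed

lemma ekeland_slice_trans:
  assumes K: "convex_cone K" and "H \<subseteq> K" and HK: "cone_convex K H"
    and "0 < \<epsilon>" "0 < l"
    and x': "x' \<in> ekeland_slice f H K \<epsilon> l x"
    and x'': "x'' \<in> ekeland_slice f H K \<epsilon> l x'"
  shows "x'' \<in> ekeland_slice f H K \<epsilon> l x"
proof -
  let ?c = "\<epsilon> / l"
  have le: "?c * dist x x'' \<le> ?c * dist x x' + ?c * dist x' x''"
    using assms(4,5) unfolding distrib_left[symmetric]
    by (intro mult_left_mono dist_triangle) auto
  have "y \<in> f x'' + (*\<^sub>R) (?c * dist x x'') ` H + K" if "y \<in> f x" for y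
  proof -
    have "y \<in> f x'' + (*\<^sub>R) (?c * dist x x' + ?c * dist x' x'') ` H + K"
      using that x' x'' assms(4,5)
      by (intro dilate_levels_add[OF K HK, where A = "f x'"]) (auto simp: ekeland_slice_def)
    then show ?thesis
      using plus_dilate_plus_antimono[OF K assms(2) le] by blast
  qed
  then show ?thesis
    unfolding ekeland_slice_def by blast
qed

lemma closed_imp_dynamically_closed:
  assumes "closed (S x)"
  shows "dynamically_closed S x"
  using assms unfolding dynamically_closed_def closed_sequential_limits by blast

section \<open>A scalar variational principle for transitive slices\<close>

text \<open>
  Each new point of the orbit \<open>u\<close> comes within \<open>2^-n\<close> of the supremum of \<open>\<phi>\<close> over the preceding slice.
  As \<open>\<phi>\<close> controls distances, the orbit is Cauchy, and every point that stays reachable from the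
  whole orbit is squeezed onto its limit.
\<close>

lemma exists_trivial_slice:
  fixes S :: "'a::metric_space \<Rightarrow> 'a set" and \<phi> :: "'a \<Rightarrow> real"
  assumes refl: "\<And>x. x \<in> S x"
    and trans: "\<And>x x' x''. x' \<in> S x \<Longrightarrow> x'' \<in> S x' \<Longrightarrow> x'' \<in> S x"
    and bdd: "bdd_above (\<phi> ` S x0)"
    and incr: "\<And>x x'. x \<in> S x0 \<Longrightarrow> x' \<in> S x \<Longrightarrow> dist x x' \<le> \<phi> x' - \<phi> x"
    and compl: "dynamically_complete S x0"
    and closed: "\<And>x. x \<in> S x0 \<Longrightarrow> dynamically_closed S x"
  obtains xbar where "xbar \<in> S x0" "S xbar = {xbar}"
proof -
  have bdd': "bdd_above (\<phi> ` S x)" if "x \<in> S x0" for x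
    using bdd by (rule bdd_above_mono) (use that trans in blast)
  have near: "\<exists>x'. x' \<in> S x0 \<and> x' \<in> S x \<and> (\<forall>z\<in>S x. \<phi> z \<le> \<phi> x' + (1/2) ^ n)"
    if x: "x \<in> S x0" for x and n :: nat
  proof -
    have "Sup (\<phi> ` S x) - (1/2) ^ n < Sup (\<phi> ` S x)"
      by simp
    moreover have "\<phi> ` S x \<noteq> {}"
      using refl[of x] by blast
    ultimately obtain x' where x': "x' \<in> S x" "Sup (\<phi> ` S x) - (1/2) ^ n < \<phi> x'"
      using less_cSup_iff[OF _ bdd'[OF x]] by blast
    have "\<phi> z \<le> \<phi> x' + (1/2) ^ n" if "z \<in> S x" for z
      using cSup_upper[OF imageI[OF that] bdd'[OF x]] x'(2) by linarith
    then show ?thesis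
      using x' trans[OF x] by blast
  qed
  have "\<exists>u. \<forall>n. (u n \<in> S x0 \<and> (n = 0 \<longrightarrow> u n = x0)) \<and>
      u (Suc n) \<in> S (u n) \<and> (\<forall>z\<in>S (u n). \<phi> z \<le> \<phi> (u (Suc n)) + (1/2) ^ n)"
    by (rule dependent_nat_choice) (use refl[of x0] near in \<open>blast+\<close>)
  then obtain u where u0: "u 0 = x0" and uS0: "\<And>n. u n \<in> S x0"
    and u_step: "\<And>n. u (Suc n) \<in> S (u n)"
    and u_near: "\<And>n z. z \<in> S (u n) \<Longrightarrow> \<phi> z \<le> \<phi> (u (Suc n)) + (1/2) ^ n"
    by blast
  have u_slice: "u n \<in> S (u m)" if "m \<le> n" for m n
    using that by (induction rule: dec_induct) (auto intro: refl trans u_step)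
  have dist_u: "dist (u m) (u n) \<le> \<phi> (u n) - \<phi> (u m)" if "m \<le> n" for m n
    using incr[OF uS0 u_slice[OF that]] .

  have "Cauchy u"
  proof -
    have mono: "incseq (\<lambda>n. \<phi> (u n))"
    proof (rule incseq_SucI)
      fix n show "\<phi> (u n) \<le> \<phi> (u (Suc n))"
        using dist_u[of n "Suc n"] zero_le_dist[of "u n" "u (Suc n)"] by linarith
    qed
    obtain M where "\<And>x. x \<in> S x0 \<Longrightarrow> \<phi> x \<le> M"
      using bdd by (auto simp: bdd_above_def)
    then have "\<forall>n. \<phi> (u n) \<le> M"
      using uS0 by blast
    then obtain L where "(\<lambda>n. \<phi> (u n)) \<longlonglongrightarrow> L"
      by (auto elim: incseq_convergent[OF mono])
    then have "convergent (\<lambda>n. \<phi> (u n))"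
      by (rule convergentI)
    then have C: "Cauchy (\<lambda>n. \<phi> (u n))"
      by (rule convergent_Cauchy)
    show ?thesis
    proof (rule metric_CauchyI)
      fix e :: real assume "0 < e"
      then obtain N where N: "\<And>m n. N \<le> m \<Longrightarrow> N \<le> n \<Longrightarrow> dist (\<phi> (u m)) (\<phi> (u n)) < e"
        using metric_CauchyD[OF C] by blast
      have "dist (u m) (u n) < e" if "N \<le> m" "N \<le> n" for m n
        using N[OF that] dist_u[of m n] dist_u[of n m] nat_le_linear[of m n]
        by (auto simp: dist_real_def dist_commute)
      then show "\<exists>N. \<forall>m\<ge>N. \<forall>n\<ge>N. dist (u m) (u n) < e"
        by blast
    qed
  qed
  then obtain xbar where lim: "u \<longlonglongrightarrow> xbar"
    using compl uS0 u_step unfolding dynamically_complete_def by blast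

  have xbar_slice: "xbar \<in> S (u n)" for n
  proof -
    \<comment> \<open>Dynamic closedness of \<open>S (u n)\<close> applies to the tail of the orbit that lies in this slice.\<close>
    have "(\<lambda>k. u (k + n)) \<longlonglongrightarrow> xbar"
      using lim by (rule LIMSEQ_ignore_initial_segment)
    moreover have "range (\<lambda>k. u (k + n)) \<subseteq> S (u n)"
      using u_slice by auto
    moreover have "u (Suc k + n) \<in> S (u (k + n))" for k
      using u_step by simp
    ultimately show ?thesis
      using closed[OF uS0[of n]] unfolding dynamically_closed_def by blast
  qed
  have "z = xbar" if z: "z \<in> S xbar" for z
  proof -
    have zS: "z \<in> S (u n)" for n
      using trans[OF xbar_slice z] .
    have "norm (dist (u (Suc n)) z) \<le> (1/2) ^ n" for n
      using incr[OF uS0 zS[of "Suc n"]] u_near[OF zS[of n]] by simp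
    moreover have "(\<lambda>n. (1/2::real) ^ n) \<longlonglongrightarrow> 0"
      by (rule LIMSEQ_realpow_zero) auto
    ultimately have "(\<lambda>n. dist (u (Suc n)) z) \<longlonglongrightarrow> 0"
      by (rule Lim_null_comparison[OF always_eventually[OF allI]])
    then have "(\<lambda>n. u (Suc n)) \<longlonglongrightarrow> z"
      by (rule tendsto_dist_iff[THEN iffD2])
    then show ?thesis
      using LIMSEQ_unique[OF LIMSEQ_Suc[OF lim]] by blast
  qed
  then have "S xbar = {xbar}"
    using refl by blast
  then show thesis
    using that xbar_slice[of 0] u0 by simp
qed

section \<open>The Ekeland variational principle for set-valued maps\<close>

theorem corollary5p5:
  fixes K H :: "'b::real_vector set"
    and f :: "'a::metric_space \<Rightarrow> 'b set"
    and x0 :: 'a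
    and \<epsilon> l :: real
  assumes "convex_cone K" and "K \<noteq> {0}" and "K \<noteq> UNIV"
    and "H \<subseteq> K" and "H \<noteq> {}" and "cone_convex K H"
    and "0 \<notin> vcl (H + K)"
    and "\<epsilon> > 0" and "l > 0"
    and "dynamically_complete (ekeland_slice f H K \<epsilon> l) x0"
    and "\<not> f x0 \<subseteq> set_image f (ekeland_slice f H K \<epsilon> l x0) + (*\<^sub>R) \<epsilon> ` H + K"
    and "\<forall>x \<in> ekeland_slice f H K \<epsilon> l x0.
           closed (ekeland_slice f H K \<epsilon> l x) \<or> dynamically_closed (ekeland_slice f H K \<epsilon> l) x"
  shows "\<exists>xbar.
           f x0 \<subseteq> f xbar + (*\<^sub>R) (\<epsilon> / l * dist x0 xbar) ` H + K
         \<and> (\<forall>x. x \<noteq> xbar \<longrightarrow> \<not> f xbar \<subseteq> f x + (*\<^sub>R) (\<epsilon> / l * dist xbar x) ` H + K)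
         \<and> dist x0 xbar \<le> l"
proof -
  define c where "c = \<epsilon> / l"
  have c: "c > 0" and cl: "c * l = \<epsilon>"
    using \<open>\<epsilon> > 0\<close> \<open>l > 0\<close> by (auto simp: c_def)
  define S where "S = ekeland_slice f H K \<epsilon> l"
  have S_iff: "x' \<in> S x \<longleftrightarrow> f x \<subseteq> f x' + (*\<^sub>R) (c * dist x x') ` H + K" for x x'
    unfolding S_def ekeland_slice_def c_def by simp
  obtain y0 where y0: "y0 \<in> f x0" "y0 \<notin> set_image f (S x0) + (*\<^sub>R) \<epsilon> ` H + K"
    using assms(11) unfolding S_def by blast
  define T where "T x = {t. 0 \<le> t \<and> y0 \<in> f x + (*\<^sub>R) t ` H + K}" for x

  have T_less: "t < \<epsilon>" if "x \<in> S x0" "t \<in> T x" for x t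
  proof (rule ccontr)
    assume "\<not> t < \<epsilon>"
    then have "y0 \<in> f x + (*\<^sub>R) \<epsilon> ` H + K"
      using plus_dilate_plus_antimono[OF assms(1,4), of \<epsilon> t "f x"] that(2) by (auto simp: T_def)
    moreover have "f x \<subseteq> set_image f (S x0)"
      using that(1) by (auto simp: set_image_def)
    ultimately show False
      using y0(2) unfolding mem_plus_dilate_plus_iff by blast
  qed
  have T_dist: "c * dist x0 x \<in> T x" if "x \<in> S x0" for x
    using that y0(1) c by (auto simp: T_def S_iff)
  have T_add: "t + c * dist x x' \<in> T x'" if "x' \<in> S x" "t \<in> T x" for x x' t
    using that c dilate_levels_add[OF assms(1,6), of t "c * dist x x'" y0 "f x" "f x'"]
    by (auto simp: T_def S_iff)
  have T_bdd: "bdd_above (T x)" if "x \<in> S x0" for x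
    using T_less[OF that] by (meson bdd_above.I less_imp_le)

  have S_refl: "x \<in> S x" for x
    unfolding S_def using assms(1,5) by (rule ekeland_slice_refl)
  have S_trans: "x'' \<in> S x" if "x' \<in> S x" "x'' \<in> S x'" for x x' x''
    using ekeland_slice_trans[OF assms(1,4,6,8,9)] that unfolding S_def by blast

  \<comment> \<open>Division by \<open>c\<close> makes the scalar value grow by the unscaled distance.\<close>
  define \<phi> where "\<phi> x = Sup (T x) / c" for x
  have incr: "dist x x' \<le> \<phi> x' - \<phi> x" if x: "x \<in> S x0" and x': "x' \<in> S x" for x x'
  proof -
    have "t \<le> Sup (T x') - c * dist x x'" if "t \<in> T x" for t
      using cSup_upper[OF T_add[OF x' that] T_bdd[OF S_trans[OF x x']]] by linarith
    then have "Sup (T x) \<le> Sup (T x') - c * dist x x'"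
      using T_dist[OF x] by (intro cSup_least) auto
    then show ?thesis
      using c by (simp add: \<phi>_def field_simps)
  qed
  have \<phi>_le: "\<phi> x \<le> l" if "x \<in> S x0" for x
  proof -
    have "Sup (T x) \<le> \<epsilon>"
      using T_dist[OF that] T_less[OF that] by (intro cSup_least) (auto intro: less_imp_le)
    then show ?thesis
      using c cl by (simp add: \<phi>_def field_simps)
  qed
  have bdd: "bdd_above (\<phi> ` S x0)"
    using \<phi>_le by (rule bdd_aboveI2)
  have compl: "dynamically_complete S x0"
    using assms(10) unfolding S_def .
  have closed: "dynamically_closed S x" if "x \<in> S x0" for x
    using assms(12) that closed_imp_dynamically_closed[of S x] unfolding S_def by blast
  obtain xbar where xbar: "xbar \<in> S x0" "S xbar = {xbar}"
    using exists_trivial_slice[of S \<phi> x0, OF S_refl _ bdd incr compl closed] S_trans by blast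

  have "c * dist x0 xbar < c * l"
    using T_less[OF xbar(1) T_dist[OF xbar(1)]] cl by simp
  then have "dist x0 xbar \<le> l"
    using c by simp
  moreover have "\<not> f xbar \<subseteq> f x + (*\<^sub>R) (\<epsilon> / l * dist xbar x) ` H + K" if "x \<noteq> xbar" for x
    using xbar(2) that S_iff[of x xbar] unfolding c_def by simp
  moreover have "f x0 \<subseteq> f xbar + (*\<^sub>R) (\<epsilon> / l * dist x0 xbar) ` H + K"
    using xbar(1) unfolding S_iff c_def .
  ultimately show ?thesis
    by (intro exI[of _ xbar] conjI allI impI)
qed

end
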